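(* Let $r^\star:\mathbb R\to[0,\infty)$ be the value function of the problem $\min_{x,s}f(x)$ s.t. $Ax+s=b$, $s\in\mathcal C$, and let $t^\star:=\min\{t\in\mathbb R:0\in\partial r^\star(t)\}$ (both as defined in the context). Let $\{\hat t_k\}$ be generated by $\hat t_{k+1}=\operatorname{prox}_{\sigma_k r^\star}(\hat t_k)$ with $\sigma_k>0$ and $\hat t_0\le t^\star$, and suppose that $\{\hat t_k\}$ is monotonically non-decreasing, $\hat t_k\le t^\star$ for all $k\in\mathbb N$, and $\hat t_k\to t^\star$. Let $\{t_k\}$ be any sequence with $t_0=\hat t_0$ such that, for some $\varsigma\ge0$ and some $\varepsilon_k\ge0$ with $\sum_{k=0}^\infty\varepsilon_k<\infty$, $$|t_{k+1}-\operatorname{prox}_{\sigma_k r^\star}(t_k)|\le\varepsilon_k\min\{1,|t_{k+1}-t_k|^\varsigma\}\quad\text{for all }k.$$ Then $\{t_k\}$ is well defined and converges to a limit $\tau$ with $$\tau\in[t^\star,t^\star+\lambda],\qquad \lambda:=\sum_{k=0}^\infty\varepsilon_k\min\{1,|t_{k+1}-t_k|^\varsigma\},$$ where $\lambda$ can be made arbitrarily small (through the choice of the tolerances $\varepsilon_k$). Additionally, if $\partial r^\star$ satisfies the calmness criterion (stated in the context), $\sigma_k\uparrow\infty$ and $\varsigma\ge1$, then the convergence rate is superlinear; if instead $\sigma_k$ remains constant, the rate is linear.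
   Context: Setting: $f:\mathbb R^n\to\mathbb R$ is closed, convex and proper, $\mathcal C\subseteq\mathbb R^m$ is a (nonempty) closed convex set, $A\in\mathbb R^{m\times n}$, $b\in\mathbb R^m$. Merit function: $r(x,s,t):=\tfrac12\max\{f(x)-t,0\}^2+\tfrac12\big(|Ax+s-b|^2+\operatorname{dist}(s,\mathcal C)^2\big)$, where $|\cdot|$ is the Euclidean norm and $\operatorname{dist}(s,\mathcal C)=\inf_{y\in\mathcal C}|s-y|$. Value function: $r^\star(t):=\min_{x,s}r(x,s,t)$, a closed, convex, proper function on $\mathbb R$. Proximal operator: $\operatorname{prox}_{\sigma h}(y):=\arg\min_x\, h(x)+\frac1{2\sigma}|x-y|^2$. Calmness criterion for $\partial h$ ($h$ closed convex proper): the solution set $S:=(\partial h)^{-1}(0)$ is nonempty, and there exist $\vartheta>0$, $\varphi>0$ such that for every $y$, with $\bar y:=\Pi_S(y)$ the Euclidean projection onto $S$, one has: $w\in\partial h(y)$ and $|w|<\vartheta$ imply $|y-\bar y|\le\varphi|w|$. Here it is applied with $h=r^\star$.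
   Formalization: In the case that the starting point t̂_0 equals t*, the step sizes σ_k are additionally assumed to have a divergent sum; otherwise the bound τ ≥ t* can fail (e.g. f(x)=x, A=1, b=0, C={0}, σ_k=2^{-k}, ς=0, ε_0=1, t_1=-1, then exact steps). *)

theory Defs
  imports "HOL-Analysis.Analysis"
begin

definition merit ::
  "(real^'n \<Rightarrow> real) \<Rightarrow> real^'n^'m \<Rightarrow> real^'m \<Rightarrow> (real^'m) set
    \<Rightarrow> real^'n \<Rightarrow> real^'m \<Rightarrow> real \<Rightarrow> real" where
  "merit f A b C x s t =
     1/2 * (max (f x - t) 0)\<^sup>2 + 1/2 * ((norm (A *v x + s - b))\<^sup>2 + (infdist s C)\<^sup>2)"

(* The minimum over (x, s) is rendered as an infimum, which equals the minimum
   whenever it is attained; the merit function is bounded below by 0, so this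
   infimum is a genuine real infimum. *)
definition value_function ::
  "(real^'n \<Rightarrow> real) \<Rightarrow> real^'n^'m \<Rightarrow> real^'m \<Rightarrow> (real^'m) set \<Rightarrow> real \<Rightarrow> real" where
  "value_function f A b C t = (INF (x, s)\<in>UNIV. merit f A b C x s t)"

definition subdifferential :: "('a::real_inner \<Rightarrow> real) \<Rightarrow> 'a \<Rightarrow> 'a set" where
  "subdifferential h x = {w. \<forall>z. h x + w \<bullet> (z - x) \<le> h z}"

definition prox_objective :: "real \<Rightarrow> ('a::real_normed_vector \<Rightarrow> real) \<Rightarrow> 'a \<Rightarrow> 'a \<Rightarrow> real" where
  "prox_objective \<sigma> h y x = h x + 1 / (2 * \<sigma>) * (norm (x - y))\<^sup>2"

definition prox :: "real \<Rightarrow> ('a::real_normed_vector \<Rightarrow> real) \<Rightarrow> 'a \<Rightarrow> 'a" where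
  "prox \<sigma> h y = (ARG_MIN (prox_objective \<sigma> h y) x. True)"

definition zeros_subdifferential :: "('a::real_inner \<Rightarrow> real) \<Rightarrow> 'a set" where
  "zeros_subdifferential h = {x. 0 \<in> subdifferential h x}"

definition calm_subdifferential :: "('a::euclidean_space \<Rightarrow> real) \<Rightarrow> bool" where
  "calm_subdifferential h \<longleftrightarrow>
     zeros_subdifferential h \<noteq> {} \<and>
     (\<exists>\<theta>>0. \<exists>\<phi>>0. \<forall>y w. w \<in> subdifferential h y \<and> norm w < \<theta> \<longrightarrow>
        norm (y - closest_point (zeros_subdifferential h) y) \<le> \<phi> * norm w)"

(* powr alone would give 0 powr 0 = 0; the convention wanted here is 0 to the power 0 = 1. *)
definition rpow :: "real \<Rightarrow> real \<Rightarrow> real" where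
  "rpow x p = (if p = 0 then 1 else x powr p)"

definition tol :: "(nat \<Rightarrow> real) \<Rightarrow> real \<Rightarrow> (nat \<Rightarrow> real) \<Rightarrow> nat \<Rightarrow> real" where
  "tol \<epsilon> \<zeta> t k = \<epsilon> k * min 1 (rpow \<bar>t (Suc k) - t k\<bar> \<zeta>)"

definition inexact_ppa ::
  "(real \<Rightarrow> real) \<Rightarrow> (nat \<Rightarrow> real) \<Rightarrow> real \<Rightarrow> (nat \<Rightarrow> real) \<Rightarrow> real \<Rightarrow> (nat \<Rightarrow> real) \<Rightarrow> bool" where
  "inexact_ppa h \<sigma> \<zeta> \<epsilon> t0 t \<longleftrightarrow>
     t 0 = t0 \<and> (\<forall>k. \<bar>t (Suc k) - prox (\<sigma> k) h (t k)\<bar> \<le> tol \<epsilon> \<zeta> t k)"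

(* Q-rates; the multiplicative form also covers sequences that reach the limit
   after finitely many steps. *)
definition linear_rate :: "(nat \<Rightarrow> real) \<Rightarrow> real \<Rightarrow> bool" where
  "linear_rate t \<tau> \<longleftrightarrow>
     (\<exists>\<rho>. 0 \<le> \<rho> \<and> \<rho> < 1 \<and> (\<forall>\<^sub>F k in sequentially. \<bar>t (Suc k) - \<tau>\<bar> \<le> \<rho> * \<bar>t k - \<tau>\<bar>))"

definition superlinear_rate :: "(nat \<Rightarrow> real) \<Rightarrow> real \<Rightarrow> bool" where
  "superlinear_rate t \<tau> \<longleftrightarrow>
     (\<exists>\<rho>. \<rho> \<longlonglongrightarrow> 0 \<and> (\<forall>\<^sub>F k in sequentially. \<bar>t (Suc k) - \<tau>\<bar> \<le> \<rho> k * \<bar>t k - \<tau>\<bar>))"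

end

theory Submission
  imports Defs
begin

text \<open>
  The value function \<open>h\<close> is convex and non-increasing, so its minimisers form the half-line
  \<open>[t\<^sup>*, \<infinity>)\<close>, the proximal map moves points to the right, and fixes exactly the minimisers.
  Hence \<open>t k + (\<Sum>j<k. tol j)\<close> is non-decreasing, and \<open>t k\<close> overshoots \<open>t\<^sup>*\<close> by at most
  the accumulated tolerances; this gives convergence and the upper bound. The limit
  cannot lie below \<open>t\<^sup>*\<close>: there the steps would be bounded below by a multiple of \<open>\<sigma> k\<close>, whereas
  \<open>\<sigma>\<close> is not summable, since \<open>h\<close> grows at most quadratically to the left of \<open>t\<^sup>*\<close> and so
  the exact iterates reduce the distance to \<open>t\<^sup>*\<close> at most by the factor \<open>1 / (1 + 4 \<sigma> k)\<close>
  in each step. For the rates, an iterate to the right of \<open>t\<^sup>*\<close> eventually stays put (as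
  \<open>\<zeta> \<ge> 1\<close> and \<open>\<epsilon> k < 1\<close>), and to the left calmness contracts the distance to \<open>t\<^sup>*\<close> by the
  factor \<open>\<phi> / (\<phi> + \<sigma> k)\<close>, up to a relative error \<open>\<epsilon> k\<close>.
\<close>

section \<open>Subgradients and the proximal map\<close>

lemma zero_mem_subdifferential_iff: "0 \<in> subdifferential h x \<longleftrightarrow> (\<forall>z. h x \<le> h z)"
  by (simp add: subdifferential_def)

lemma subdifferential_monotone:
  assumes "v \<in> subdifferential h x" "w \<in> subdifferential h y"
  shows "0 \<le> (v - w) \<bullet> (x - y)"
proof -
  have "h x + v \<bullet> (y - x) \<le> h y" "h y + w \<bullet> (x - y) \<le> h x"
    using assms by (auto simp: subdifferential_def)
  then show ?thesis by (simp add: inner_diff_left inner_diff_right)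
qed

text \<open>As \<open>h\<close> is bounded below, the quadratic penalty alone lifts the objective
  outside a ball around \<open>y\<close> to at least its value at \<open>y\<close>; compactness of
  the ball does the rest.\<close>

lemma prox_objective_arg_min_exists:
  fixes h :: "'a::euclidean_space \<Rightarrow> real"
  assumes conv: "convex_on UNIV h" and bdd: "\<And>x. m \<le> h x" and s: "\<sigma> > 0"
  shows "\<exists>p. is_arg_min (prox_objective \<sigma> h y) (\<lambda>_. True) p"
proof -
  define F where "F = prox_objective \<sigma> h y"
  \<comment> \<open>Chosen so that the lower bound \<open>m\<close> plus the penalty at distance
    \<open>R\<close> is exactly \<open>h y\<close>.\<close>
  define R where "R = sqrt (2 * \<sigma> * (h y - m))"
  have R: "R \<ge> 0" "R\<^sup>2 = 2 * \<sigma> * (h y - m)"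
    using s bdd[of y] by (auto simp: R_def)
  have "continuous_on UNIV h" by (rule convex_on_continuous[OF open_UNIV conv])
  then have "continuous_on (cball y R) F"
    unfolding F_def prox_objective_def
    by (intro continuous_intros) (auto intro: continuous_on_subset)
  then obtain p where p: "p \<in> cball y R" "\<And>x. x \<in> cball y R \<Longrightarrow> F p \<le> F x"
    using continuous_attains_inf[of "cball y R" F] R by auto
  have "F p \<le> F x" for x
  proof (cases "x \<in> cball y R")
    case False
    then have "R\<^sup>2 \<le> (norm (x - y))\<^sup>2"
      using R(1) by (intro power_mono) (auto simp: dist_norm norm_minus_commute)
    then have "h y - m \<le> 1 / (2 * \<sigma>) * (norm (x - y))\<^sup>2"
      using s by (simp add: R(2) field_simps)
    then have "F y \<le> F x" using bdd[of x] by (simp add: F_def prox_objective_def)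
    moreover have "F p \<le> F y" using R(1) by (intro p(2)) simp
    ultimately show ?thesis by simp
  qed (rule p(2))
  then show ?thesis by (auto simp: is_arg_min_linorder F_def)
qed

text \<open>First-order optimality: comparing \<open>p\<close> with the point at fraction
  \<open>u\<close> of the segment to \<open>z\<close> gives the subgradient inequality up to
  \<open>u * q\<close>, an error that vanishes as \<open>u\<close> tends to 0.\<close>

lemma arg_min_prox_objective_subgradient:
  fixes h :: "'a::real_inner \<Rightarrow> real"
  assumes conv: "convex_on UNIV h" and s: "\<sigma> > 0"
    and p: "is_arg_min (prox_objective \<sigma> h y) (\<lambda>_. True) p"
  shows "(1 / \<sigma>) *\<^sub>R (y - p) \<in> subdifferential h p"
proof -
  have "h p + ((1 / \<sigma>) *\<^sub>R (y - p)) \<bullet> (z - p) \<le> h z" for z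
  proof -
    define q where "q = (norm (z - p))\<^sup>2 / (2 * \<sigma>)"
    have le: "h p + ((1 / \<sigma>) *\<^sub>R (y - p)) \<bullet> (z - p) \<le> h z + u * q" if u: "0 < u" "u < 1" for u
    proof -
      define c where "c = 1 / (2 * \<sigma>)"
      have exp: "(norm (u *\<^sub>R e - a))\<^sup>2
          = u\<^sup>2 * (norm e)\<^sup>2 - 2 * u * (a \<bullet> e) + (norm a)\<^sup>2" for a e :: 'a
        unfolding power2_norm_eq_inner
        by (simp add: inner_diff_left inner_diff_right inner_commute power2_eq_square algebra_simps)
      have "(1 - u) *\<^sub>R p + u *\<^sub>R z - y = u *\<^sub>R (z - p) - (y - p)"
        by (simp add: algebra_simps)
      moreover have "prox_objective \<sigma> h y p \<le> prox_objective \<sigma> h y ((1 - u) *\<^sub>R p + u *\<^sub>R z)"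
        using p by (auto simp: is_arg_min_linorder)
      ultimately have "h p + c * (norm (y - p))\<^sup>2 \<le> h ((1 - u) *\<^sub>R p + u *\<^sub>R z)
          + c * (u\<^sup>2 * (norm (z - p))\<^sup>2 - 2 * u * ((y - p) \<bullet> (z - p)) + (norm (y - p))\<^sup>2)"
        unfolding prox_objective_def exp[symmetric] c_def by (simp only: norm_minus_commute[of y p])
      moreover have "h ((1 - u) *\<^sub>R p + u *\<^sub>R z) \<le> (1 - u) * h p + u * h z"
        using convex_onD[OF conv, of u p z] u by auto
      ultimately have "u * h p \<le> u * h z
          + c * (u\<^sup>2 * (norm (z - p))\<^sup>2 - 2 * u * ((y - p) \<bullet> (z - p)))"
        by (simp add: algebra_simps)
      also have "\<dots> = u * (h z + u * q - ((1 / \<sigma>) *\<^sub>R (y - p)) \<bullet> (z - p))"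
        using s unfolding inner_scaleR_left q_def c_def by (simp add: field_simps power2_eq_square)
      finally show ?thesis using u by simp
    qed
    have "((\<lambda>u. h z + u * q) \<longlongrightarrow> h z + 0 * q) (at_right 0)"
      by (intro tendsto_intros)
    moreover have "eventually (\<lambda>u. h p + ((1 / \<sigma>) *\<^sub>R (y - p)) \<bullet> (z - p) \<le> h z + u * q) (at_right 0)"
      by (rule eventually_mono[OF eventually_at_right_real[OF zero_less_one]]) (rule le; simp)
    ultimately have "h p + ((1 / \<sigma>) *\<^sub>R (y - p)) \<bullet> (z - p) \<le> h z + 0 * q"
      by (rule tendsto_lowerbound) simp
    then show ?thesis by simp
  qed
  then show ?thesis by (simp add: subdifferential_def)
qed

text \<open>Monotonicity of the subdifferential at \<open>p\<close> and \<open>q\<close> gives firm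
  nonexpansiveness; Cauchy-Schwarz then cancels one factor \<open>norm (p - q)\<close>. The case
  \<open>y = z\<close> yields uniqueness of the proximal point.\<close>

lemma resolvent_nonexpansive:
  assumes s: "\<sigma> > 0"
    and p: "(1 / \<sigma>) *\<^sub>R (y - p) \<in> subdifferential h p"
    and q: "(1 / \<sigma>) *\<^sub>R (z - q) \<in> subdifferential h q"
  shows "norm (p - q) \<le> norm (y - z)"
proof -
  have "0 \<le> ((1 / \<sigma>) *\<^sub>R (y - p) - (1 / \<sigma>) *\<^sub>R (z - q)) \<bullet> (p - q)"
    by (rule subdifferential_monotone[OF p q])
  also have "\<dots> = (1 / \<sigma>) * ((y - z) \<bullet> (p - q) - (p - q) \<bullet> (p - q))"
    by (simp add: algebra_simps inner_diff_left inner_diff_right)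
  finally have "(p - q) \<bullet> (p - q) \<le> (y - z) \<bullet> (p - q)"
    using s by (simp add: zero_le_divide_iff)
  also have "\<dots> \<le> norm (y - z) * norm (p - q)" by (rule norm_cauchy_schwarz)
  finally have "norm (p - q) * norm (p - q) \<le> norm (y - z) * norm (p - q)"
    by (simp add: power2_norm_eq_inner[symmetric] power2_eq_square)
  then show ?thesis by (cases "p = q") auto
qed

lemma prox_objective_arg_min_unique:
  fixes h :: "'a::euclidean_space \<Rightarrow> real"
  assumes "convex_on UNIV h" "\<And>x. m \<le> h x" "\<sigma> > 0"
  shows "\<exists>!p. is_arg_min (prox_objective \<sigma> h y) (\<lambda>_. True) p"
proof (rule ex_ex1I)
  show "\<exists>p. is_arg_min (prox_objective \<sigma> h y) (\<lambda>_. True) p"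
    by (rule prox_objective_arg_min_exists[OF assms])
  fix p q assume "is_arg_min (prox_objective \<sigma> h y) (\<lambda>_. True) p"
    "is_arg_min (prox_objective \<sigma> h y) (\<lambda>_. True) q"
  then have "norm (p - q) \<le> norm (y - y)"
    by (intro resolvent_nonexpansive[of \<sigma> _ _ h] arg_min_prox_objective_subgradient assms)
  then show "p = q" by simp
qed

lemma prox_subgradient:
  fixes h :: "'a::euclidean_space \<Rightarrow> real"
  assumes "convex_on UNIV h" "\<And>x. m \<le> h x" "\<sigma> > 0"
  shows "(1 / \<sigma>) *\<^sub>R (y - prox \<sigma> h y) \<in> subdifferential h (prox \<sigma> h y)"
proof -
  have "is_arg_min (prox_objective \<sigma> h y) (\<lambda>_. True) (prox \<sigma> h y)"
    unfolding prox_def arg_min_def using prox_objective_arg_min_exists[OF assms] by (rule someI_ex)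
  then show ?thesis by (rule arg_min_prox_objective_subgradient[OF assms(1,3)])
qed

section \<open>The value function\<close>

text \<open>Squaring is increasing on nonnegative reals and convex, with defect
  \<open>u * (1 - u) * (x - y)\<^sup>2\<close>.\<close>

lemma square_le_convex_combination:
  fixes a x y u :: real
  assumes "0 \<le> a" "a \<le> (1 - u) * x + u * y" "0 \<le> u" "u \<le> 1"
  shows "a\<^sup>2 \<le> (1 - u) * x\<^sup>2 + u * y\<^sup>2"
proof -
  have "a\<^sup>2 \<le> ((1 - u) * x + u * y)\<^sup>2" using assms by (intro power_mono) auto
  also have "\<dots> = (1 - u) * x\<^sup>2 + u * y\<^sup>2 - u * (1 - u) * (x - y)\<^sup>2"
    by (simp add: power2_eq_square algebra_simps)
  also have "\<dots> \<le> (1 - u) * x\<^sup>2 + u * y\<^sup>2" using assms by simp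
  finally show ?thesis .
qed

text \<open>The convex combination of nearest points of \<open>x\<close> and \<open>y\<close> lies
  in \<open>C\<close> and bounds the distance.\<close>

lemma infdist_convex_combination_le:
  fixes C :: "'a::euclidean_space set"
  assumes C: "C \<noteq> {}" "closed C" "convex C" and u: "0 \<le> u" "u \<le> 1"
  shows "infdist ((1 - u) *\<^sub>R x + u *\<^sub>R y) C \<le> (1 - u) * infdist x C + u * infdist y C"
proof -
  obtain c d where c: "c \<in> C" "infdist x C = dist x c" and d: "d \<in> C" "infdist y C = dist y d"
    using infdist_attains_inf[OF C(2,1)] by metis
  have "(1 - u) *\<^sub>R c + u *\<^sub>R d \<in> C"
    using convexD_alt[OF C(3) c(1) d(1)] u by blast
  then have "infdist ((1 - u) *\<^sub>R x + u *\<^sub>R y) C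
      \<le> dist ((1 - u) *\<^sub>R x + u *\<^sub>R y) ((1 - u) *\<^sub>R c + u *\<^sub>R d)"
    by (rule infdist_le)
  also have "\<dots> = norm ((1 - u) *\<^sub>R (x - c) + u *\<^sub>R (y - d))"
    by (simp add: dist_norm algebra_simps)
  also have "\<dots> \<le> norm ((1 - u) *\<^sub>R (x - c)) + norm (u *\<^sub>R (y - d))"
    by (rule norm_triangle_ineq)
  also have "\<dots> = (1 - u) * infdist x C + u * infdist y C"
    using u by (simp add: c d dist_norm)
  finally show ?thesis .
qed

lemma merit_nonneg: "0 \<le> merit f A b C x s t"
  by (simp add: merit_def)

lemma value_function_le: "value_function f A b C t \<le> merit f A b C x s t"
  unfolding value_function_def
  by (rule cINF_lower2[where x = "(x, s)"]) (auto intro!: bdd_belowI[where m = 0] simp: merit_nonneg)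

lemma le_value_function: "(\<And>x s. m \<le> merit f A b C x s t) \<Longrightarrow> m \<le> value_function f A b C t"
  unfolding value_function_def by (rule cINF_greatest) auto

lemma value_function_nonneg: "0 \<le> value_function f A b C t"
  by (rule le_value_function) (rule merit_nonneg)

text \<open>Attainment of the infimum is not established, so near-minimisers replace
  minimisers.\<close>

lemma merit_near_value_function:
  assumes "e > 0"
  obtains x s where "merit f A b C x s t < value_function f A b C t + e"
  using le_value_function[of "value_function f A b C t + e" f A b C t] assms
  by (meson less_add_same_cancel1 not_le)

text \<open>Joint convexity in all three arguments: each term is the square of a nonnegative convex
  function.\<close>

lemma merit_convex_combination_le:
  assumes f: "convex_on UNIV f" and C: "C \<noteq> {}" "closed C" "convex C" and u: "0 \<le> u" "u \<le> 1"
  shows "merit f A b C ((1 - u) *\<^sub>R x + u *\<^sub>R x') ((1 - u) *\<^sub>R s + u *\<^sub>R s') ((1 - u) * t + u * t')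
    \<le> (1 - u) * merit f A b C x s t + u * merit f A b C x' s' t'"
proof -
  let ?x = "(1 - u) *\<^sub>R x + u *\<^sub>R x'" and ?s = "(1 - u) *\<^sub>R s + u *\<^sub>R s'" and ?t = "(1 - u) * t + u * t'"
  have "f ?x \<le> (1 - u) * f x + u * f x'" using convex_onD[OF f, of u x x'] u by auto
  moreover have "(1 - u) * (f x - t) \<le> (1 - u) * max (f x - t) 0"
    "u * (f x' - t') \<le> u * max (f x' - t') 0"
    using u by (auto intro!: mult_left_mono)
  ultimately have "f ?x - ?t \<le> (1 - u) * max (f x - t) 0 + u * max (f x' - t') 0"
    by (simp add: algebra_simps)
  moreover have "0 \<le> (1 - u) * max (f x - t) 0 + u * max (f x' - t') 0" using u by simp
  ultimately have 1: "(max (f ?x - ?t) 0)\<^sup>2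
      \<le> (1 - u) * (max (f x - t) 0)\<^sup>2 + u * (max (f x' - t') 0)\<^sup>2"
    using u by (intro square_le_convex_combination) auto
  have "A *v ?x + ?s - b = (1 - u) *\<^sub>R (A *v x + s - b) + u *\<^sub>R (A *v x' + s' - b)"
    by (simp add: matrix_vector_right_distrib matrix_vector_mult_scaleR algebra_simps)
  then have "norm (A *v ?x + ?s - b)
      \<le> norm ((1 - u) *\<^sub>R (A *v x + s - b)) + norm (u *\<^sub>R (A *v x' + s' - b))"
    using norm_triangle_ineq by metis
  then have 2: "(norm (A *v ?x + ?s - b))\<^sup>2
      \<le> (1 - u) * (norm (A *v x + s - b))\<^sup>2 + u * (norm (A *v x' + s' - b))\<^sup>2"
    using u by (intro square_le_convex_combination) auto
  have 3: "(infdist ?s C)\<^sup>2 \<le> (1 - u) * (infdist s C)\<^sup>2 + u * (infdist s' C)\<^sup>2"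
    using u by (intro square_le_convex_combination infdist_convex_combination_le C infdist_nonneg)
  have "(1 - u) * merit f A b C x s t + u * merit f A b C x' s' t'
      = 1/2 * ((1 - u) * (max (f x - t) 0)\<^sup>2 + u * (max (f x' - t') 0)\<^sup>2)
        + 1/2 * (((1 - u) * (norm (A *v x + s - b))\<^sup>2 + u * (norm (A *v x' + s' - b))\<^sup>2)
          + ((1 - u) * (infdist s C)\<^sup>2 + u * (infdist s' C)\<^sup>2))"
    unfolding merit_def by (simp add: field_simps)
  moreover have "merit f A b C ?x ?s ?t \<le> \<dots>"
    unfolding merit_def by (intro add_mono mult_left_mono 1 2 3) auto
  ultimately show ?thesis by simp
qed

text \<open>Partial minimisation preserves joint convexity.\<close>

lemma convex_on_value_function:
  assumes "convex_on UNIV f" "C \<noteq> {}" "closed C" "convex C"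
  shows "convex_on UNIV (value_function f A b C)"
proof (rule convex_onI)
  fix u t t' :: real assume u: "0 < u" "u < 1"
  show "value_function f A b C ((1 - u) *\<^sub>R t + u *\<^sub>R t')
    \<le> (1 - u) * value_function f A b C t + u * value_function f A b C t'"
  proof (rule field_le_epsilon)
    fix e :: real assume "e > 0"
    then obtain x s x' s' where 1: "merit f A b C x s t < value_function f A b C t + e"
      and 2: "merit f A b C x' s' t' < value_function f A b C t' + e"
      by (metis merit_near_value_function)
    have "value_function f A b C ((1 - u) *\<^sub>R t + u *\<^sub>R t')
        \<le> merit f A b C ((1 - u) *\<^sub>R x + u *\<^sub>R x') ((1 - u) *\<^sub>R s + u *\<^sub>R s') ((1 - u) *\<^sub>R t + u *\<^sub>R t')"
      by (rule value_function_le)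
    also have "\<dots> \<le> (1 - u) * merit f A b C x s t + u * merit f A b C x' s' t'"
      using merit_convex_combination_le[OF assms, of u] u by simp
    also have "\<dots> \<le> (1 - u) * (value_function f A b C t + e) + u * (value_function f A b C t' + e)"
      using 1 2 u by (intro add_mono mult_left_mono) auto
    finally show "value_function f A b C ((1 - u) *\<^sub>R t + u *\<^sub>R t')
        \<le> (1 - u) * value_function f A b C t + u * value_function f A b C t' + e"
      by (simp add: algebra_simps)
  qed
qed simp

lemma antimono_value_function: "antimono (value_function f A b C)"
proof (rule antimonoI)
  fix t t' :: real assume "t \<le> t'"
  then have "merit f A b C x s t' \<le> merit f A b C x s t" for x s
    by (auto simp: merit_def intro!: power_mono)
  then show "value_function f A b C t' \<le> value_function f A b C t"
    by (meson le_value_function value_function_le order_trans)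
qed

text \<open>Midpoint form of the concavity of \<open>h t - t\<^sup>2 / 2\<close>: \<open>h\<close> is essentially a Moreau envelope.\<close>

lemma value_function_second_difference_le:
  assumes d: "d \<ge> 0"
  shows "value_function f A b C (t - d) + value_function f A b C (t + d)
    \<le> 2 * value_function f A b C t + d\<^sup>2"
proof -
  \<comment> \<open>For \<open>v \<ge> 0\<close>, dropping the second positive part leaves the
    parallelogram identity; for \<open>v < 0\<close> only the first term can survive, and it is at
    most \<open>d\<^sup>2\<close>.\<close>
  have sq: "(max (v + d) 0)\<^sup>2 + (max (v - d) 0)\<^sup>2 \<le> 2 * (max v 0)\<^sup>2 + 2 * d\<^sup>2" for v :: real
  proof (cases "v \<ge> 0")
    case True
    have "\<bar>max (v - d) 0\<bar> \<le> \<bar>v - d\<bar>" by auto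
    then have "(max (v - d) 0)\<^sup>2 \<le> (v - d)\<^sup>2" by (simp only: abs_le_square_iff)
    with True d show ?thesis by (simp add: power2_eq_square algebra_simps)
  next
    case False
    then have "(max (v + d) 0)\<^sup>2 \<le> d\<^sup>2" using d by (intro power_mono) auto
    moreover have "(max (v - d) 0)\<^sup>2 = 0" "(max v 0)\<^sup>2 = 0" using False d by auto
    ultimately show ?thesis using zero_le_power2[of d] by linarith
  qed
  \<comment> \<open>The same pair \<open>(x, s)\<close> serves at \<open>t - d\<close>,
    \<open>t\<close> and \<open>t + d\<close>, so the bound passes to the infimum at
    \<open>t\<close>.\<close>
  have "(value_function f A b C (t - d) + value_function f A b C (t + d) - d\<^sup>2) / 2
      \<le> merit f A b C x s t" for x s
  proof -
    have "merit f A b C x s (t - d) + merit f A b C x s (t + d) \<le> 2 * merit f A b C x s t + d\<^sup>2"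
      using sq[of "f x - t"] by (simp add: merit_def algebra_simps)
    then show ?thesis
      using value_function_le[of f A b C "t - d" x s] value_function_le[of f A b C "t + d" x s]
      by simp
  qed
  then have "(value_function f A b C (t - d) + value_function f A b C (t + d) - d\<^sup>2) / 2
      \<le> value_function f A b C t" by (rule le_value_function)
  then show ?thesis by simp
qed

section \<open>Proximal iterations for non-increasing convex functions\<close>

text \<open>Collects what the iteration uses of the value function. \<open>T\<close> is the least
  minimiser, and \<open>quadratic_growth\<close> is an upper bound: it limits how fast exact steps
  can approach \<open>T\<close>.\<close>

locale antimono_convex =
  fixes h :: "real \<Rightarrow> real" and T :: real
  assumes conv: "convex_on UNIV h"
    and anti: "antimono h"
    and min: "h T \<le> h z"
    and least: "z < T \<Longrightarrow> h T < h z"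
    and quadratic_growth: "0 \<le> d \<Longrightarrow> h (T - d) \<le> h T + d\<^sup>2"
begin

lemma eq_min: "T \<le> y \<Longrightarrow> h y = h T"
  using min[of y] antimonoD[OF anti, of T y] by simp

lemma zeros_subdifferential_eq: "zeros_subdifferential h = {T..}"
proof -
  have "T \<le> x \<longleftrightarrow> (\<forall>z. h x \<le> h z)" for x
    using eq_min[of x] min least[of x] by (metis not_le)
  then show ?thesis by (auto simp: zeros_subdifferential_def zero_mem_subdifferential_iff)
qed

lemma prox_subgradient':
  assumes "\<sigma> > 0"
  shows "(y - prox \<sigma> h y) / \<sigma> \<in> subdifferential h (prox \<sigma> h y)"
  using prox_subgradient[OF conv min assms, of y] by (simp add: divide_inverse mult.commute)

lemma prox_inequality:
  assumes "\<sigma> > 0"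
  shows "h (prox \<sigma> h y) + (y - prox \<sigma> h y) / \<sigma> * (z - prox \<sigma> h y) \<le> h z"
  using prox_subgradient'[OF assms, of y] by (simp add: subdifferential_def)

text \<open>Subgradients of a non-increasing function are nonpositive; testing at distance 1 to the
  right shows this for \<open>(y - prox \<sigma> h y) / \<sigma>\<close>.\<close>

lemma le_prox:
  assumes s: "\<sigma> > 0"
  shows "y \<le> prox \<sigma> h y"
proof -
  have "(y - prox \<sigma> h y) / \<sigma> \<le> 0"
    using prox_inequality[OF s, of y "prox \<sigma> h y + 1"]
      antimonoD[OF anti, of "prox \<sigma> h y" "prox \<sigma> h y + 1"] by simp
  then show ?thesis using s by (simp add: divide_le_0_iff)
qed

text \<open>Beyond \<open>max y T\<close> the subgradient would be negative, forcing a strict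
  decrease from the minimiser \<open>max y T\<close>.\<close>

lemma prox_le_max:
  assumes s: "\<sigma> > 0"
  shows "prox \<sigma> h y \<le> max y T"
proof (rule ccontr)
  assume "\<not> prox \<sigma> h y \<le> max y T"
  then have "0 < (y - prox \<sigma> h y) / \<sigma> * (max y T - prox \<sigma> h y)"
    using s by (intro mult_neg_neg) (auto simp: divide_less_0_iff)
  then show False
    using prox_inequality[OF s, of y "max y T"] eq_min[of "max y T"] min[of "prox \<sigma> h y"] by simp
qed

lemma prox_eq_self: "\<sigma> > 0 \<Longrightarrow> T \<le> y \<Longrightarrow> prox \<sigma> h y = y"
  using le_prox[of \<sigma> y] prox_le_max[of \<sigma> y] by simp

text \<open>The step divided by \<sigma> is the slope at the proximal point, and quadratic growth
  makes this slope at most 4 times the distance to \<open>T\<close>.\<close>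

lemma prox_step_le:
  assumes s: "\<sigma> > 0" and y: "y \<le> T"
  shows "prox \<sigma> h y - y \<le> 4 * \<sigma> * (T - prox \<sigma> h y)"
proof -
  define p d v where "p = prox \<sigma> h y" and "d = T - p" and "v = (p - y) / \<sigma>"
  have d: "d \<ge> 0" using prox_le_max[OF s, of y] y by (simp add: d_def p_def)
  have le: "v * e \<le> (d + e)\<^sup>2" if "e > 0" for e
  proof -
    have "v * e = (y - p) / \<sigma> * (p - e - p)" by (simp add: v_def left_diff_distrib diff_divide_distrib)
    then have "h p + v * e \<le> h (p - e)"
      using prox_inequality[OF s, of y "p - e"] by (simp only: p_def)
    also have "\<dots> \<le> h T + (d + e)\<^sup>2"
      using quadratic_growth[of "d + e"] d that by (simp add: d_def algebra_simps)
    finally show ?thesis using min[of p] by simp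
  qed
  have "v \<le> 4 * d"
  proof (cases "d = 0")
    case True
    have "v \<le> 0 + e" if "e > 0" for e
      using le[OF that] that True by (simp add: power2_eq_square)
    then show ?thesis using True field_le_epsilon[of v 0] by simp
  next
    case False
    then have "d > 0" using d by simp
    then show ?thesis using le[of d] by (simp add: power2_eq_square)
  qed
  then show ?thesis using s by (simp add: v_def d_def p_def field_simps)
qed

section \<open>Step sizes and convergence of the inexact iteration\<close>

text \<open>Since \<open>1 + 4 * \<sigma> n\<close> is at most \<open>exp (4 * \<sigma> n)\<close>,
  summable step sizes would keep the distance to \<open>T\<close> above a positive constant. The
  strict start excludes the constant sequence \<open>T\<close>.\<close>

lemma exact_iteration_step_sizes_not_summable:
  assumes s: "\<And>k. \<sigma> k > 0" and step: "\<And>k. u (Suc k) = prox (\<sigma> k) h (u k)"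
    and start: "u 0 < T" and le: "\<And>k. u k \<le> T" and lim: "u \<longlonglongrightarrow> T"
  shows "\<not> summable \<sigma>"
proof
  assume sum: "summable \<sigma>"
  have bound: "T - u 0 \<le> (T - u n) * exp (4 * (\<Sum>k<n. \<sigma> k))" for n
  proof (induction n)
    case (Suc n)
    have "T - u n \<le> (T - u (Suc n)) * (1 + 4 * \<sigma> n)"
      using prox_step_le[OF s le, of n n] by (simp add: step algebra_simps)
    also have "\<dots> \<le> (T - u (Suc n)) * exp (4 * \<sigma> n)"
      using le[of "Suc n"] exp_ge_add_one_self[of "4 * \<sigma> n"] by (intro mult_left_mono) auto
    finally have "(T - u n) * exp (4 * (\<Sum>k<n. \<sigma> k))
        \<le> (T - u (Suc n)) * exp (4 * \<sigma> n) * exp (4 * (\<Sum>k<n. \<sigma> k))"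
      by (intro mult_right_mono) auto
    then show ?case using Suc by (simp add: algebra_simps flip: exp_add)
  qed simp
  have "(\<lambda>n. (T - u n) * exp (4 * (\<Sum>k<n. \<sigma> k))) \<longlonglongrightarrow> (T - T) * exp (4 * suminf \<sigma>)"
    by (intro tendsto_intros lim summable_LIMSEQ sum)
  then have "T - u 0 \<le> (T - T) * exp (4 * suminf \<sigma>)"
    by (rule LIMSEQ_le_const) (use bound in auto)
  with start show False by simp
qed

lemma inexact_iteration_converges:
  assumes s: "\<And>k. \<sigma> k > 0" and not_summable: "\<not> summable \<sigma>"
    and e: "\<And>k. 0 \<le> e k" "summable e"
    and step: "\<And>k. \<bar>t (Suc k) - prox (\<sigma> k) h (t k)\<bar> \<le> e k"
    and start: "t 0 \<le> T"
  shows "\<exists>\<tau>. t \<longlonglongrightarrow> \<tau> \<and> \<tau> \<in> {T .. T + suminf e}"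
proof -
  define E where "E n = (\<Sum>k<n. e k)" for n
  have E: "E \<longlonglongrightarrow> suminf e" unfolding E_def by (rule summable_LIMSEQ[OF e(2)])
  have E_le: "E n \<le> suminf e" for n unfolding E_def by (intro sum_le_suminf e) auto
  have upper: "t n \<le> T + E n" for n
  proof (induction n)
    case (Suc n)
    have "0 \<le> E n" unfolding E_def by (intro sum_nonneg e)
    then show ?case
      using Suc step[of n] prox_le_max[OF s, of n "t n"] by (auto simp: E_def)
  qed (use start in \<open>simp add: E_def\<close>)
  \<comment> \<open>The exact step never moves left, so the inexact one loses at most
    \<open>e n\<close>.\<close>
  have incr: "t n + E n \<le> t (Suc n) + E (Suc n)" for n
    using step[of n] le_prox[OF s, of "t n" n] by (auto simp: E_def)
  have mono: "incseq (\<lambda>n. t n + E n)" using incr by (rule incseq_SucI)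
  have "\<forall>n. t n + E n \<le> T + 2 * suminf e"
  proof
    show "t n + E n \<le> T + 2 * suminf e" for n using upper[of n] E_le[of n] by simp
  qed
  then obtain L where L: "(\<lambda>n. t n + E n) \<longlonglongrightarrow> L"
    using incseq_convergent[OF mono] by blast
  define \<tau> where "\<tau> = L - suminf e"
  have lim: "t \<longlonglongrightarrow> \<tau>" using tendsto_diff[OF L E] by (simp add: \<tau>_def)
  have "\<tau> \<le> T + suminf e"
  proof (rule LIMSEQ_le_const2[OF lim], intro exI allI impI)
    show "t n \<le> T + suminf e" for n using upper[of n] E_le[of n] by simp
  qed
  moreover have "T \<le> \<tau>"
  proof (rule ccontr)
    assume "\<not> T \<le> \<tau>"
    then have lt: "\<tau> < T" by simp
    define p where "p k = prox (\<sigma> k) h (t k)" for k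
    have "(\<lambda>k. t (Suc k) - p k) \<longlonglongrightarrow> 0"
      using step by (intro tendsto_rabs_zero_cancel[OF tendsto_sandwich[OF _ _ tendsto_const
            summable_LIMSEQ_zero[OF e(2)]]]) (auto simp: p_def)
    from tendsto_diff[OF LIMSEQ_Suc[OF lim] this] have p: "p \<longlonglongrightarrow> \<tau>" by simp
    \<comment> \<open>Iterates \<open>p k\<close> below this midpoint have suboptimality at least
      \<open>h m - h T > 0\<close>.\<close>
    define m where "m = (\<tau> + T) / 2"
    have m: "\<tau> < m" "m < T" using lt by (auto simp: m_def)
    \<comment> \<open>The denominator bounds \<open>T - p k\<close>; its slack 1 allows
      \<open>p k\<close> to lie slightly left of \<tau>.\<close>
    define c where "c = (h m - h T) / (T - \<tau> + 1)"
    have c: "c > 0" using lt least[OF m(2)] by (simp add: c_def)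
    have "eventually (\<lambda>k. p k < m \<and> \<tau> - 1 < p k) sequentially"
      using order_tendstoD[OF p] m(1) by (intro eventually_conj) auto
    then obtain K where K: "\<And>k. k \<ge> K \<Longrightarrow> p k < m" "\<And>k. k \<ge> K \<Longrightarrow> \<tau> - 1 < p k"
      by (auto simp: eventually_sequentially)
    \<comment> \<open>The increments of the convergent sequence \<open>t k + E k\<close> telescope,
      so dominating \<sigma> by them makes \<sigma> summable.\<close>
    have \<sigma>_le: "c * \<sigma> k \<le> (t (Suc k) + E (Suc k)) - (t k + E k)" if k: "k \<ge> K" for k
    proof -
      have neg: "(t k - p k) / \<sigma> k = - ((p k - t k) / \<sigma> k)" by (simp add: diff_divide_distrib)
      have "h m - h T \<le> h (p k) - h T" using K(1)[OF k] antimonoD[OF anti, of "p k" m] by simp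
      also have "\<dots> \<le> (p k - t k) / \<sigma> k * (T - p k)"
        using prox_inequality[OF s, of k "t k" T, folded p_def] unfolding neg by linarith
      also have "\<dots> \<le> (p k - t k) / \<sigma> k * (T - \<tau> + 1)"
        using s[of k] le_prox[OF s, of "t k" k] K(2)[OF k]
        by (intro mult_left_mono) (auto simp: p_def)
      finally have "c \<le> (p k - t k) / \<sigma> k" using lt by (simp add: c_def divide_le_eq)
      then have "c * \<sigma> k \<le> p k - t k" using s[of k] by (simp add: le_divide_eq)
      then show ?thesis using step[of k] by (auto simp: E_def p_def)
    qed
    have "summable (\<lambda>k. (t (Suc k) + E (Suc k)) - (t k + E k))"
      using telescope_summable[OF L] .
    then have "summable (\<lambda>k. c * \<sigma> k)"
      using \<sigma>_le c s less_imp_le[of 0 "\<sigma> _"]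
      by (intro summable_comparison_test[of "\<lambda>k. c * \<sigma> k"]) (auto simp: abs_mult)
    then show False using c not_summable by (simp add: summable_cmult_iff)
  qed
  ultimately show ?thesis using lim by auto
qed

section \<open>Convergence rates under calmness\<close>

text \<open>One factor covers both rates. The lower bound \<open>s0\<close> turns small steps into
  small subgradients, so that calmness eventually applies.\<close>

lemma eventually_contraction:
  assumes calm: "calm_subdifferential h" and s0: "s0 > 0" and s: "\<And>k. s0 \<le> \<sigma> k"
    and eps: "\<And>k. 0 \<le> \<epsilon> k" "\<epsilon> \<longlonglongrightarrow> 0" and \<zeta>: "\<zeta> \<ge> 1"
    and step: "\<And>k. \<bar>t (Suc k) - prox (\<sigma> k) h (t k)\<bar> \<le> tol \<epsilon> \<zeta> t k"
    and lim: "t \<longlonglongrightarrow> \<tau>" and \<tau>: "T \<le> \<tau>"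
  obtains \<phi> where "\<phi> > 0" "\<forall>\<^sub>F k in sequentially.
    \<bar>t (Suc k) - \<tau>\<bar> \<le> (\<phi> / (\<phi> + \<sigma> k) + \<epsilon> k) / (1 - \<epsilon> k) * \<bar>t k - \<tau>\<bar>"
proof -
  have s_pos: "\<sigma> k > 0" for k using s0 s[of k] by simp
  obtain \<theta> \<phi> where \<theta>: "\<theta> > 0" and \<phi>: "\<phi> > 0"
    and calm: "\<And>y w. w \<in> subdifferential h y \<Longrightarrow> \<bar>w\<bar> < \<theta> \<Longrightarrow> \<bar>y - closest_point {T..} y\<bar> \<le> \<phi> * \<bar>w\<bar>"
    using calm unfolding calm_subdifferential_def zeros_subdifferential_eq real_norm_def by blast
  define \<delta> where "\<delta> k = \<bar>t (Suc k) - t k\<bar>" for k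
  have \<delta>: "\<delta> \<longlonglongrightarrow> 0"
    using tendsto_rabs[OF tendsto_diff[OF LIMSEQ_Suc[OF lim] lim]] by (simp add: \<delta>_def[abs_def])
  \<comment> \<open>Consequently a late iterate left of \<open>T\<close> forces
    \<open>\<tau> = T\<close>.\<close>
  have "eventually (\<lambda>k. \<tau> > T \<longrightarrow> t k > T) sequentially"
    using order_tendstoD(1)[OF lim, of T] by (cases "\<tau> > T") auto
  \<comment> \<open>The three bounds serve, in order, to absorb the error, to get
    \<open>rpow (\<delta> k) \<zeta> \<le> \<delta> k\<close>, and to bring the subgradient below
    \<theta>.\<close>
  moreover have "eventually (\<lambda>k. \<epsilon> k < 1 \<and> \<delta> k < 1 \<and> \<delta> k < \<theta> * s0 / 2) sequentially"
    using order_tendstoD(2)[OF eps(2), of 1] order_tendstoD(2)[OF \<delta>, of 1]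
      order_tendstoD(2)[OF \<delta>, of "\<theta> * s0 / 2"] \<theta> s0 by (auto intro!: eventually_conj)
  ultimately have "eventually (\<lambda>k. (\<tau> > T \<longrightarrow> t k > T) \<and> \<epsilon> k < 1 \<and> \<delta> k < 1 \<and> \<delta> k < \<theta> * s0 / 2) sequentially"
    by (rule eventually_conj)
  then obtain K where K: "\<And>k. k \<ge> K \<Longrightarrow> \<tau> > T \<Longrightarrow> t k > T" "\<And>k. k \<ge> K \<Longrightarrow> \<epsilon> k < 1"
    "\<And>k. k \<ge> K \<Longrightarrow> \<delta> k < 1" "\<And>k. k \<ge> K \<Longrightarrow> \<delta> k < \<theta> * s0 / 2"
    unfolding eventually_sequentially by blast
  have step': "\<bar>t (Suc k) - prox (\<sigma> k) h (t k)\<bar> \<le> \<epsilon> k * \<delta> k" if k: "k \<ge> K" for k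
  proof -
    have "rpow (\<delta> k) \<zeta> \<le> \<delta> k"
      using powr_mono'[of 1 \<zeta> "\<delta> k"] K(3)[OF k] \<zeta> by (auto simp: rpow_def \<delta>_def)
    then have "min 1 (rpow (\<delta> k) \<zeta>) \<le> \<delta> k" by simp
    then have "tol \<epsilon> \<zeta> t k \<le> \<epsilon> k * \<delta> k"
      unfolding tol_def \<delta>_def[symmetric] by (intro mult_left_mono eps)
    with step[of k] show ?thesis by simp
  qed
  \<comment> \<open>The proximal map fixes \<open>t k\<close>, so
    \<open>\<delta> k \<le> \<epsilon> k * \<delta> k\<close> with
    \<open>\<epsilon> k < 1\<close>.\<close>
  have stays: "t (Suc k) = t k" if k: "k \<ge> K" and ge: "T \<le> t k" for k
  proof -
    have "\<delta> k \<le> \<epsilon> k * \<delta> k" using step'[OF k] prox_eq_self[OF s_pos ge] by (simp add: \<delta>_def)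
    moreover have "\<epsilon> k * \<delta> k < 1 * \<delta> k" if "\<delta> k > 0" using K(2)[OF k] that by (rule mult_strict_right_mono)
    ultimately have "\<not> \<delta> k > 0" by auto
    then show ?thesis by (simp add: \<delta>_def)
  qed
  have contraction: "\<bar>t (Suc k) - \<tau>\<bar> \<le> (\<phi> / (\<phi> + \<sigma> k) + \<epsilon> k) / (1 - \<epsilon> k) * \<bar>t k - \<tau>\<bar>"
    if k: "k \<ge> K" for k
  proof (cases "T \<le> t k")
    case True
    have const: "t (k + n) = t k" for n
    proof (induction n)
      case (Suc n)
      then show ?case using stays[of "k + n"] k True by simp
    qed simp
    have "(\<lambda>n. t (n + k)) \<longlonglongrightarrow> \<tau>" using lim by (rule LIMSEQ_ignore_initial_segment)
    then have "\<tau> = t k" using const by (simp add: add.commute LIMSEQ_const_iff)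
    then show ?thesis using const[of 1] by simp
  next
    case False
    then have lt: "t k < T" and \<tau>_eq: "\<tau> = T" using K(1)[OF k] \<tau> by (auto simp: not_le intro: antisym leI)
    define p where "p = prox (\<sigma> k) h (t k)"
    define w where "w = (t k - p) / \<sigma> k"
    have p: "t k \<le> p" "p \<le> T"
      using le_prox[OF s_pos, of "t k" k] prox_le_max[OF s_pos, of k "t k"] lt by (auto simp: p_def)
    have w: "\<bar>w\<bar> = (p - t k) / \<sigma> k" using p(1) s_pos[of k] by (simp add: w_def)
    have "\<epsilon> k * \<delta> k \<le> 1 * \<delta> k" using K(2)[OF k] by (intro mult_right_mono) (auto simp: \<delta>_def)
    moreover have "p - t k \<le> \<bar>t (Suc k) - p\<bar> + \<delta> k" unfolding \<delta>_def by linarith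
    ultimately have "p - t k \<le> 2 * \<delta> k" using step'[OF k] by (simp add: p_def)
    also have "\<dots> < \<theta> * s0" using K(4)[OF k] by simp
    also have "\<dots> \<le> \<theta> * \<sigma> k" using \<theta> s by simp
    finally have "\<bar>w\<bar> < \<theta>" using s_pos[of k] by (simp add: w divide_less_eq)
    moreover have "w \<in> subdifferential h p" unfolding w_def p_def by (rule prox_subgradient'[OF s_pos])
    ultimately have "\<bar>p - closest_point {T..} p\<bar> \<le> \<phi> * \<bar>w\<bar>" by (intro calm)
    moreover have "T \<le> closest_point {T..} p" using closest_point_in_set[of "{T..}" p] by simp
    ultimately have "T - p \<le> \<phi> * ((p - t k) / \<sigma> k)" using w by simp
    \<comment> \<open>Splitting \<open>p - t k\<close> as \<open>(T - t k) - (T - p)\<close> moves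
      the unknown \<open>T - p\<close> to the left.\<close>
    then have "(T - p) * (\<phi> + \<sigma> k) \<le> \<phi> * (T - t k)"
      using s_pos[of k] by (simp add: field_simps)
    then have Tp: "T - p \<le> \<phi> / (\<phi> + \<sigma> k) * (T - t k)"
      using s_pos[of k] \<phi> by (simp add: le_divide_eq)
    have "\<bar>t (Suc k) - T\<bar> \<le> \<epsilon> k * \<delta> k + (T - p)"
      using step'[OF k] p by (auto simp: p_def)
    \<comment> \<open>\<open>\<delta> k\<close> is split at \<open>T\<close>; the part with
      \<open>t (Suc k)\<close> moves to the left and produces the factor
      \<open>1 - \<epsilon> k\<close>.\<close>
    also have "\<dots> \<le> \<epsilon> k * (\<bar>t (Suc k) - T\<bar> + (T - t k)) + \<phi> / (\<phi> + \<sigma> k) * (T - t k)"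
      using lt by (intro add_mono mult_left_mono eps Tp) (auto simp: \<delta>_def)
    finally have "\<bar>t (Suc k) - T\<bar> * (1 - \<epsilon> k) \<le> (\<phi> / (\<phi> + \<sigma> k) + \<epsilon> k) * (T - t k)"
      by (simp add: algebra_simps)
    then show ?thesis using K(2)[OF k] lt by (simp add: \<tau>_eq le_divide_eq)
  qed
  show ?thesis
    by (rule that[OF \<phi>]) (use contraction in \<open>auto simp: eventually_sequentially\<close>)
qed

lemma superlinear_rateI:
  assumes calm: "calm_subdifferential h" and s: "incseq \<sigma>" "\<sigma> 0 > 0" "filterlim \<sigma> at_top sequentially"
    and eps: "\<And>k. 0 \<le> \<epsilon> k" "\<epsilon> \<longlonglongrightarrow> 0" and \<zeta>: "\<zeta> \<ge> 1"
    and step: "\<And>k. \<bar>t (Suc k) - prox (\<sigma> k) h (t k)\<bar> \<le> tol \<epsilon> \<zeta> t k"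
    and lim: "t \<longlonglongrightarrow> \<tau>" and \<tau>: "T \<le> \<tau>"
  shows "superlinear_rate t \<tau>"
proof -
  obtain \<phi> where "\<phi> > 0" and ev: "\<forall>\<^sub>F k in sequentially.
    \<bar>t (Suc k) - \<tau>\<bar> \<le> (\<phi> / (\<phi> + \<sigma> k) + \<epsilon> k) / (1 - \<epsilon> k) * \<bar>t k - \<tau>\<bar>"
    using eventually_contraction[OF calm s(2) incseqD[OF s(1)] eps \<zeta> step lim \<tau>] by blast
  have "(\<lambda>k. \<phi> / (\<phi> + \<sigma> k)) \<longlonglongrightarrow> 0"
    by (intro tendsto_divide_0[OF tendsto_const] filterlim_at_top_imp_at_infinity
        filterlim_tendsto_add_at_top[OF tendsto_const] s(3))
  then have "(\<lambda>k. (\<phi> / (\<phi> + \<sigma> k) + \<epsilon> k) / (1 - \<epsilon> k)) \<longlonglongrightarrow> (0 + 0) / (1 - 0)"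
    by (intro tendsto_divide tendsto_add tendsto_diff tendsto_const eps) auto
  then show ?thesis
    unfolding superlinear_rate_def using ev by (intro exI[of _ "\<lambda>k. (\<phi> / (\<phi> + \<sigma> k) + \<epsilon> k) / (1 - \<epsilon> k)"]) simp
qed

lemma linear_rateI:
  assumes calm: "calm_subdifferential h" and s: "\<And>k. \<sigma> k = c" "c > 0"
    and eps: "\<And>k. 0 \<le> \<epsilon> k" "\<epsilon> \<longlonglongrightarrow> 0" and \<zeta>: "\<zeta> \<ge> 1"
    and step: "\<And>k. \<bar>t (Suc k) - prox (\<sigma> k) h (t k)\<bar> \<le> tol \<epsilon> \<zeta> t k"
    and lim: "t \<longlonglongrightarrow> \<tau>" and \<tau>: "T \<le> \<tau>"
  shows "linear_rate t \<tau>"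
proof -
  have "c \<le> \<sigma> k" for k by (simp add: s)
  then obtain \<phi> where \<phi>: "\<phi> > 0" and ev: "\<forall>\<^sub>F k in sequentially.
    \<bar>t (Suc k) - \<tau>\<bar> \<le> (\<phi> / (\<phi> + \<sigma> k) + \<epsilon> k) / (1 - \<epsilon> k) * \<bar>t k - \<tau>\<bar>"
    using eventually_contraction[OF calm s(2) _ eps \<zeta> step lim \<tau>] by blast
  define q where "q = \<phi> / (\<phi> + c)"
  have q: "0 \<le> q" "q < 1" using \<phi> s(2) by (auto simp: q_def)
  have "(\<lambda>k. (q + \<epsilon> k) / (1 - \<epsilon> k)) \<longlonglongrightarrow> (q + 0) / (1 - 0)"
    by (intro tendsto_divide tendsto_add tendsto_diff tendsto_const eps) auto
  \<comment> \<open>The contraction factor tends to \<open>q < 1\<close>; the midpoint of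
    \<open>q\<close> and 1 leaves room for the errors.\<close>
  then have "\<forall>\<^sub>F k in sequentially. (q + \<epsilon> k) / (1 - \<epsilon> k) < (1 + q) / 2"
    using q by (intro order_tendstoD(2)[of _ "(q + 0) / (1 - 0)"]) auto
  with ev have "\<forall>\<^sub>F k in sequentially. \<bar>t (Suc k) - \<tau>\<bar> \<le> (1 + q) / 2 * \<bar>t k - \<tau>\<bar>"
  proof eventually_elim
    case (elim k)
    have "\<bar>t (Suc k) - \<tau>\<bar> \<le> (q + \<epsilon> k) / (1 - \<epsilon> k) * \<bar>t k - \<tau>\<bar>"
      using elim(1) by (simp only: q_def s(1))
    also have "\<dots> \<le> (1 + q) / 2 * \<bar>t k - \<tau>\<bar>"
      using elim(2) by (intro mult_right_mono) auto
    finally show ?case .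
  qed
  then show ?thesis unfolding linear_rate_def using q by (intro exI[of _ "(1 + q) / 2"]) auto
qed

end

section \<open>Tolerances and the convergence theorem\<close>

lemma tol_bounds:
  assumes "0 \<le> \<epsilon> k"
  shows "0 \<le> tol \<epsilon> \<zeta> t k" "tol \<epsilon> \<zeta> t k \<le> \<epsilon> k"
  using assms by (auto simp: tol_def rpow_def intro!: mult_nonneg_nonneg mult_left_le)

lemma summable_tol:
  assumes "\<And>k. 0 \<le> \<epsilon> k" "summable \<epsilon>"
  shows "summable (tol \<epsilon> \<zeta> t)"
  using assms by (intro summable_comparison_test[OF _ assms(2)]) (auto simp: tol_bounds)

lemma inexact_tolerances_arbitrarily_small:
  assumes exact: "\<And>k. u (Suc k) = prox (\<sigma> k) h (u k)" and \<eta>: "\<eta> > 0"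
  shows "\<exists>\<epsilon>. (\<forall>k. \<epsilon> k > 0) \<and> summable \<epsilon>
    \<and> (\<exists>t. inexact_ppa h \<sigma> \<zeta> \<epsilon> (u 0) t)
    \<and> (\<forall>t. inexact_ppa h \<sigma> \<zeta> \<epsilon> (u 0) t \<longrightarrow> summable (tol \<epsilon> \<zeta> t) \<and> (\<Sum>k. tol \<epsilon> \<zeta> t k) < \<eta>)"
proof -
  \<comment> \<open>Geometric tolerances with sum \<open>\<eta> / 2\<close>, which dominates the
    error sum of every admissible sequence.\<close>
  define \<epsilon> where "\<epsilon> k = \<eta> / 4 * (1 / 2) ^ k" for k :: nat
  have pos: "\<epsilon> k > 0" for k using \<eta> by (simp add: \<epsilon>_def)
  have sums: "\<epsilon> sums (\<eta> / 4 * 2)"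
    unfolding \<epsilon>_def using sums_mult[OF geometric_sums[of "1 / 2 :: real"], of "\<eta> / 4"] by simp
  \<comment> \<open>The exact iteration is itself admissible, so the claim is not vacuous.\<close>
  have "inexact_ppa h \<sigma> \<zeta> \<epsilon> (u 0) u"
    by (simp add: inexact_ppa_def exact tol_bounds less_imp_le[OF pos])
  moreover have "summable (tol \<epsilon> \<zeta> t) \<and> (\<Sum>k. tol \<epsilon> \<zeta> t k) < \<eta>" for t
  proof
    show tol: "summable (tol \<epsilon> \<zeta> t)"
      using pos sums by (intro summable_tol) (auto simp: less_imp_le sums_iff)
    have "(\<Sum>k. tol \<epsilon> \<zeta> t k) \<le> suminf \<epsilon>"
      using sums by (intro suminf_le tol_bounds tol less_imp_le[OF pos]) (simp add: sums_iff)
    also have "\<dots> < \<eta>" using sums \<eta> by (simp add: sums_iff)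
    finally show "(\<Sum>k. tol \<epsilon> \<zeta> t k) < \<eta>" .
  qed
  ultimately show ?thesis using pos sums by (auto simp: sums_iff)
qed

text \<open>Well-definedness appears as unique existence of every proximal point. For
  \<open>that 0 = tstar\<close> the exact sequence is constant and says nothing about the step
  sizes; \<open>degenerate_start\<close> covers that case.\<close>

theorem theorem7:
  fixes f :: "real^'n \<Rightarrow> real" and A :: "real^'n^'m" and b :: "real^'m" and C :: "(real^'m) set"
    and tstar :: real and \<sigma> \<epsilon> that t :: "nat \<Rightarrow> real" and \<zeta> :: real
  assumes f_convex: "convex_on UNIV f" and f_closed: "closed (epigraph UNIV f)"
    and C: "C \<noteq> {}" "closed C" "convex C"
    and tstar_zero: "0 \<in> subdifferential (value_function f A b C) tstar"
    and tstar_least: "\<And>u. 0 \<in> subdifferential (value_function f A b C) u \<Longrightarrow> tstar \<le> u"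
    and \<sigma>_pos: "\<And>k. \<sigma> k > 0"
    and that_step: "\<And>k. that (Suc k) = prox (\<sigma> k) (value_function f A b C) (that k)"
    and that_start: "that 0 \<le> tstar"
    and that_mono: "incseq that"
    and that_le: "\<And>k. that k \<le> tstar"
    and that_lim: "that \<longlonglongrightarrow> tstar"
    and degenerate_start: "that 0 = tstar \<Longrightarrow> \<not> summable \<sigma>"
    and \<zeta>: "\<zeta> \<ge> 0"
    and \<epsilon>_nonneg: "\<And>k. \<epsilon> k \<ge> 0" and \<epsilon>_summable: "summable \<epsilon>"
    and t: "inexact_ppa (value_function f A b C) \<sigma> \<zeta> \<epsilon> (that 0) t"
  shows "(\<forall>k y. \<exists>!p. is_arg_min (prox_objective (\<sigma> k) (value_function f A b C) y) (\<lambda>_. True) p)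
    \<and> summable (tol \<epsilon> \<zeta> t)
    \<and> (\<exists>\<tau>. t \<longlonglongrightarrow> \<tau> \<and> \<tau> \<in> {tstar .. tstar + (\<Sum>k. tol \<epsilon> \<zeta> t k)}
        \<and> (calm_subdifferential (value_function f A b C) \<and> incseq \<sigma>
              \<and> filterlim \<sigma> at_top sequentially \<and> \<zeta> \<ge> 1
            \<longrightarrow> superlinear_rate t \<tau>)
        \<and> (calm_subdifferential (value_function f A b C) \<and> (\<exists>c. \<forall>k. \<sigma> k = c) \<and> \<zeta> \<ge> 1
            \<longrightarrow> linear_rate t \<tau>))
    \<and> (\<forall>\<eta>>0. \<exists>\<epsilon>'. (\<forall>k. \<epsilon>' k > 0) \<and> summable \<epsilon>'
        \<and> (\<exists>t'. inexact_ppa (value_function f A b C) \<sigma> \<zeta> \<epsilon>' (that 0) t')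
        \<and> (\<forall>t'. inexact_ppa (value_function f A b C) \<sigma> \<zeta> \<epsilon>' (that 0) t'
            \<longrightarrow> summable (tol \<epsilon>' \<zeta> t') \<and> (\<Sum>k. tol \<epsilon>' \<zeta> t' k) < \<eta>))"
proof -
  let ?h = "value_function f A b C"
  interpret antimono_convex ?h tstar
  proof
    show "convex_on UNIV ?h" by (rule convex_on_value_function[OF f_convex C])
    show "antimono ?h" by (rule antimono_value_function)
    show min: "?h tstar \<le> ?h z" for z
      using tstar_zero by (simp add: zero_mem_subdifferential_iff)
    show "?h tstar < ?h z" if "z < tstar" for z
      using tstar_least[of z] that min by (metis zero_mem_subdifferential_iff not_le order_trans)
    \<comment> \<open>The second-difference bound at \<open>tstar\<close>, with the value at
      \<open>tstar + d\<close> bounded below by the minimum.\<close>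
    show "?h (tstar - d) \<le> ?h tstar + d\<^sup>2" if "0 \<le> d" for d
      using value_function_second_difference_le[OF that, of f A b C tstar] min[of "tstar + d"] by simp
  qed
  have t0: "t 0 = that 0" and step: "\<bar>t (Suc k) - prox (\<sigma> k) ?h (t k)\<bar> \<le> tol \<epsilon> \<zeta> t k" for k
    using t by (auto simp: inexact_ppa_def)
  have \<epsilon>_lim: "\<epsilon> \<longlonglongrightarrow> 0" by (rule summable_LIMSEQ_zero[OF \<epsilon>_summable])
  have "\<not> summable \<sigma>"
    using degenerate_start that_start
      exact_iteration_step_sizes_not_summable[OF \<sigma>_pos that_step _ that_le that_lim]
    by (cases "that 0 = tstar") auto
  moreover have tol: "summable (tol \<epsilon> \<zeta> t)" by (rule summable_tol[OF \<epsilon>_nonneg \<epsilon>_summable])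
  ultimately obtain \<tau> where \<tau>: "t \<longlonglongrightarrow> \<tau>" "\<tau> \<in> {tstar .. tstar + (\<Sum>k. tol \<epsilon> \<zeta> t k)}"
    using inexact_iteration_converges[where e = "tol \<epsilon> \<zeta> t", OF \<sigma>_pos _ tol_bounds(1)[of \<epsilon>, OF \<epsilon>_nonneg] _ step]
      t0 that_start by auto
  have "superlinear_rate t \<tau>"
    if "calm_subdifferential ?h \<and> incseq \<sigma> \<and> filterlim \<sigma> at_top sequentially \<and> \<zeta> \<ge> 1"
    using that \<tau> by (intro superlinear_rateI[OF _ _ \<sigma>_pos _ \<epsilon>_nonneg \<epsilon>_lim _ step]) auto
  moreover have "linear_rate t \<tau>"
    if const: "calm_subdifferential ?h \<and> (\<exists>c. \<forall>k. \<sigma> k = c) \<and> \<zeta> \<ge> 1"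
  proof -
    obtain c where "\<And>k. \<sigma> k = c" using const by blast
    moreover from this have "c > 0" using \<sigma>_pos[of 0] by simp
    ultimately show ?thesis
      using const \<tau> by (intro linear_rateI[OF _ _ _ \<epsilon>_nonneg \<epsilon>_lim _ step]) auto
  qed
  moreover have "\<exists>!p. is_arg_min (prox_objective (\<sigma> k) ?h y) (\<lambda>_. True) p" for k y
    by (rule prox_objective_arg_min_unique[OF conv min \<sigma>_pos])
  ultimately show ?thesis
    using \<tau> tol
    by (intro conjI allI impI exI[of _ \<tau>] inexact_tolerances_arbitrarily_small that_step) auto
qed

end
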